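(* Let $(X,T)$ be a Cantor minimal system given by a Bratteli-Vershik representation $B=(V,E,\preceq)$ with incidence matrices $(M(n))_{n\ge 2}$, and let $\lambda=\exp(2i\pi\alpha)$, $\alpha\in\mathbb{R}$, be a continuous eigenvalue of $(X,T)$. Then there exist $m\in\mathbb{N}$, $m\geq 1$, $v\in\mathbb{R}^{C(m)}$ and $w\in\mathbb{Z}^{C(m)}$ such that $$\alpha P(m)H(1)=v+w\quad\text{and}\quad P(n,m)v\to 0 \text{ as } n\to\infty .$$
   Context: A Cantor minimal system $(X,T)$ is a homeomorphism $T$ of a Cantor set $X$ all of whose orbits are dense. A complex number $\lambda$ is a continuous eigenvalue of $(X,T)$ if there is a continuous $f:X\to\mathbb{C}$, $f\neq 0$, with $f\circ T=\lambda f$. Bratteli-Vershik representations. A Bratteli diagram is an infinite graph with vertex set $V=\bigsqcup_{n\ge0}V_n$ and edge set $E=\bigsqcup_{n\ge1}E_n$, all levels finite, $V_0=\{v_0\}$, $V_n=\{1,\dots,C(n)\}$ for $n\geq 1$; edges in $E_n$ go from $V_{n-1}$ (initial point) to $V_n$ (end-point); every vertex of $V_n$, $n\ge1$, is the end-point of an edge of $E_n$ and every vertex of $V_n$, $n\ge 0$, is the initial point of an edge of $E_{n+1}$. It is ordered by a partial order $\preceq$ on $E$ for which two edges are comparable iff they have the same end-point. $X_B$ is the compact space of infinite paths $(e_1,e_2,\dots)$, $e_n\in E_n$, starting at $v_0$, with basis the cylinder sets $[e_1,\dots,e_n]$. The diagram is properly ordered if there is exactly one path $x_{\max}$ all of whose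 edges are maximal and exactly one path $x_{\min}$ all of whose edges are minimal. The Vershik map $V_B$ sends $x_{\max}$ to $x_{\min}$ and, for $x\ne x_{\max}$, if $k$ is least with $x_k$ not maximal, sends $x$ to $(y_1,\dots,y_{k-1},y_k,x_{k+1},\dots)$ where $y_k$ is the successor of $x_k$ and $(y_1,\dots,y_{k-1})$ is the path of minimal edges from $v_0$ to the initial point of $y_k$. $(X,T)$ is given by $B$ if $B$ is properly ordered and $(X,T)=(X_B,V_B)$ up to conjugacy. For $n\ge2$, $M(n)$ is the $V_n\times V_{n-1}$ matrix whose $(i,j)$ entry is the number of edges in $E_n$ from $j\in V_{n-1}$ to $i\in V_n$. Standing assumptions: all entries of each $M(n)$ are positive, and there is exactly one edge from $v_0$ to each vertex of $V_1$, so $H(1)=(1,\dots,1)^T\in\mathbb{N}^{C(1)}$. Put $P(1)=I$, $P(n)=M(n)\cdots M(2)$, $P(n,n)=I$, $P(n,m)=M(n)\cdots M(m+1)$ for $n>m$. Vectors are normed by $\|v\|=\max_i|v_i|$. *)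

theory Defs
  imports
    "HOL-Analysis.Function_Topology"
    "Jordan_Normal_Form.Matrix"
begin

definition cantor_set :: "'a topology \<Rightarrow> bool" where
  "cantor_set X \<longleftrightarrow>
    X homeomorphic_space product_topology (\<lambda>_::nat. discrete_topology (UNIV :: bool set)) UNIV"

definition orbit_on :: "'a topology \<Rightarrow> ('a \<Rightarrow> 'a) \<Rightarrow> 'a \<Rightarrow> 'a set" where
  "orbit_on X T x =
    range (\<lambda>n. (T ^^ n) x) \<union> range (\<lambda>n. (inv_into (topspace X) T ^^ n) x)"

definition cantor_minimal_system :: "'a topology \<Rightarrow> ('a \<Rightarrow> 'a) \<Rightarrow> bool" where
  "cantor_minimal_system X T \<longleftrightarrow>
    cantor_set X \<and> homeomorphic_map X X T \<and>
    (\<forall>x\<in>topspace X. X closure_of orbit_on X T x = topspace X)"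

definition continuous_eigenvalue :: "'a topology \<Rightarrow> ('a \<Rightarrow> 'a) \<Rightarrow> complex \<Rightarrow> bool" where
  "continuous_eigenvalue X T lam \<longleftrightarrow>
    (\<exists>f. continuous_map X euclidean f \<and> (\<exists>x\<in>topspace X. f x \<noteq> 0) \<and>
         (\<forall>x\<in>topspace X. f (T x) = lam * f x))"

text \<open>
  A diagram with an order on its edges. The vertices of level \<open>n \<ge> 1\<close> are named
  \<open>1, \<dots>, C(n)\<close> with \<open>C(n) = nverts B n\<close>, and the root is named \<open>0\<close>. The same number names
  vertices of several levels, so \<open>src e\<close> and \<open>tgt e\<close> are to be read at levels \<open>n - 1\<close> and \<open>n\<close>
  when \<open>e \<in> edges B n\<close>. The values \<open>nverts B 0\<close> and \<open>edges B 0\<close> are never used.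
\<close>

record 'e bratteli =
  nverts :: "nat \<Rightarrow> nat"
  edges :: "nat \<Rightarrow> 'e set"
  src :: "'e \<Rightarrow> nat"
  tgt :: "'e \<Rightarrow> nat"
  edge_order :: "'e rel"

definition verts :: "'e bratteli \<Rightarrow> nat \<Rightarrow> nat set" where
  "verts B n = (if n = 0 then {0} else {1..nverts B n})"

definition all_edges :: "'e bratteli \<Rightarrow> 'e set" where
  "all_edges B = (\<Union>n\<in>{1..}. edges B n)"

definition bratteli_diagram :: "'e bratteli \<Rightarrow> bool" where
  "bratteli_diagram B \<longleftrightarrow>
    disjoint_family_on (edges B) {1..} \<and>
    (\<forall>n\<ge>1. finite (edges B n) \<and>
            src B ` edges B n = verts B (n - 1) \<and>
            tgt B ` edges B n = verts B n)"

definition ordered_bratteli_diagram :: "'e bratteli \<Rightarrow> bool" where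
  "ordered_bratteli_diagram B \<longleftrightarrow>
    bratteli_diagram B \<and>
    partial_order_on (all_edges B) (edge_order B) \<and>
    (\<forall>n\<ge>1. \<forall>m\<ge>1. \<forall>e\<in>edges B n. \<forall>f\<in>edges B m.
       (e, f) \<in> edge_order B \<or> (f, e) \<in> edge_order B \<longleftrightarrow> n = m \<and> tgt B e = tgt B f)"

definition max_edge :: "'e bratteli \<Rightarrow> 'e \<Rightarrow> bool" where
  "max_edge B e \<longleftrightarrow> e \<in> all_edges B \<and> (\<forall>f. (e, f) \<in> edge_order B \<longrightarrow> f = e)"

definition min_edge :: "'e bratteli \<Rightarrow> 'e \<Rightarrow> bool" where
  "min_edge B e \<longleftrightarrow> e \<in> all_edges B \<and> (\<forall>f. (f, e) \<in> edge_order B \<longrightarrow> f = e)"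

definition edge_succ :: "'e bratteli \<Rightarrow> 'e \<Rightarrow> 'e \<Rightarrow> bool" where
  "edge_succ B e f \<longleftrightarrow>
    (e, f) \<in> edge_order B \<and> f \<noteq> e \<and>
    (\<forall>g. (e, g) \<in> edge_order B \<and> (g, f) \<in> edge_order B \<longrightarrow> g = e \<or> g = f)"

text \<open>
  A path \<open>(e\<^sub>1, e\<^sub>2, \<dots>)\<close> is a function on \<open>{1..}\<close>, with the value \<open>undefined\<close> at \<open>0\<close>. It starts at the
  root because every edge of level \<open>1\<close> does.
\<close>

definition paths :: "'e bratteli \<Rightarrow> (nat \<Rightarrow> 'e) set" where
  "paths B = {x \<in> Pi\<^sub>E {1..} (edges B). \<forall>n\<ge>1. tgt B (x n) = src B (x (Suc n))}"

definition cylinder :: "'e bratteli \<Rightarrow> nat \<Rightarrow> (nat \<Rightarrow> 'e) \<Rightarrow> (nat \<Rightarrow> 'e) set" where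
  "cylinder B n e = {x \<in> paths B. \<forall>i\<in>{1..n}. x i = e i}"

definition path_space :: "'e bratteli \<Rightarrow> (nat \<Rightarrow> 'e) topology" where
  "path_space B = topology_generated_by {cylinder B n e |n e. 1 \<le> n \<and> e \<in> paths B}"

definition max_path :: "'e bratteli \<Rightarrow> (nat \<Rightarrow> 'e) \<Rightarrow> bool" where
  "max_path B x \<longleftrightarrow> x \<in> paths B \<and> (\<forall>n\<ge>1. max_edge B (x n))"

definition min_path :: "'e bratteli \<Rightarrow> (nat \<Rightarrow> 'e) \<Rightarrow> bool" where
  "min_path B x \<longleftrightarrow> x \<in> paths B \<and> (\<forall>n\<ge>1. min_edge B (x n))"

definition properly_ordered :: "'e bratteli \<Rightarrow> bool" where
  "properly_ordered B \<longleftrightarrow>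
    ordered_bratteli_diagram B \<and> (\<exists>!x. max_path B x) \<and> (\<exists>!x. min_path B x)"

text \<open>
  In the second case, \<open>y \<in> paths B\<close> forces \<open>(y\<^sub>1, \<dots>, y\<^sub>k\<^sub>-\<^sub>1)\<close> to end at the initial point of \<open>y\<^sub>k\<close>, and
  a path of minimal edges from the root to a given vertex is unique, so the description is
  definite on \<open>paths B\<close>. Values outside \<open>paths B\<close> are irrelevant.
\<close>

definition vershik :: "'e bratteli \<Rightarrow> (nat \<Rightarrow> 'e) \<Rightarrow> (nat \<Rightarrow> 'e)" where
  "vershik B x =
    (if max_path B x then (THE y. min_path B y)
     else let k = (LEAST k. 1 \<le> k \<and> \<not> max_edge B (x k))
          in THE y. y \<in> paths B \<and> (\<forall>i\<in>{1..<k}. min_edge B (y i)) \<and>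
                    edge_succ B (x k) (y k) \<and> (\<forall>i>k. y i = x i))"

definition given_by :: "'a topology \<Rightarrow> ('a \<Rightarrow> 'a) \<Rightarrow> 'e bratteli \<Rightarrow> bool" where
  "given_by X T B \<longleftrightarrow>
    properly_ordered B \<and>
    (\<exists>h. homeomorphic_map (path_space B) X h \<and>
         (\<forall>x\<in>topspace (path_space B). h (vershik B x) = T (h x)))"

text \<open>
  Vectors and matrices are indexed from \<open>0\<close>, so the index \<open>i\<close> stands for the vertex \<open>Suc i\<close>.
\<close>

definition incidence :: "'e bratteli \<Rightarrow> nat \<Rightarrow> real mat" where
  "incidence B n = mat (nverts B n) (nverts B (n - 1))
    (\<lambda>(i, j). of_nat (card {e \<in> edges B n. src B e = Suc j \<and> tgt B e = Suc i}))"

definition standing_assumptions :: "'e bratteli \<Rightarrow> bool" where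
  "standing_assumptions B \<longleftrightarrow>
    (\<forall>n\<ge>2. \<forall>i<nverts B n. \<forall>j<nverts B (n - 1). incidence B n $$ (i, j) > 0) \<and>
    (\<forall>i\<in>verts B 1. \<exists>!e. e \<in> edges B 1 \<and> tgt B e = i)"

definition H1 :: "'e bratteli \<Rightarrow> real vec" where
  "H1 B = vec (nverts B 1) (\<lambda>_. 1)"

text \<open>
  For \<open>n \<ge> m\<close>, \<open>inc_prod B n m\<close> is \<open>P(n,m) = M(n) \<cdots> M(m+1)\<close>; for \<open>n < m\<close> it is a dummy value.
  In particular \<open>P(n) = inc_prod B n 1\<close>.
\<close>

primrec inc_prod :: "'e bratteli \<Rightarrow> nat \<Rightarrow> nat \<Rightarrow> real mat" where
  "inc_prod B 0 m = 1\<^sub>m (nverts B m)"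
| "inc_prod B (Suc n) m =
    (if m \<le> n then incidence B (Suc n) * inc_prod B n m else 1\<^sub>m (nverts B m))"

definition max_norm :: "real vec \<Rightarrow> real" where
  "max_norm v = Max ((\<lambda>i. \<bar>v $ i\<bar>) ` {..<dim_vec v})"

end

(* Let g be the eigenfunction on the path space. The paths with n minimal first edges shrink to the
   unique minimal path, where g is not 0, so lambda^s is uniformly close to 1 for all times s at
   which a path returns to this set. The partial sums of the heights of the sources of the ordered
   edges into a vertex of level n + 1 are such times. So if v(n) is the difference between
   alpha H(n) and the nearest integer vector, then v(n) tends to 0, and along the ordered edges into
   a vertex the partial sums of v(n) stay close to the integers. As the steps are small, they
   stay close to 0 (although M(n+1) may be large), which forces v(n+1) = M(n+1) v(n) from some
   level m on. *)

theory Submission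
  imports Defs "HOL-Analysis.Complex_Transcendental"
begin

section \<open>Sorted listings of finite sets and iterates of maps\<close>

lemma finite_total_preorder_sorted_list:
  assumes "finite A" and "trans r" and "\<And>a b. a \<in> A \<Longrightarrow> b \<in> A \<Longrightarrow> (a, b) \<in> r \<or> (b, a) \<in> r"
  shows "\<exists>es. distinct es \<and> set es = A \<and> sorted_wrt (\<lambda>a b. (a, b) \<in> r) es"
  using assms(1,3)
proof (induction A)
  case empty
  then show ?case by simp
next
  case (insert x F)
  then obtain es where es: "distinct es" "set es = F" "sorted_wrt (\<lambda>a b. (a, b) \<in> r) es"
    by auto
  \<comment> \<open>The new element goes after the elements below it. By totality it is below all
    the others, and transitivity through \<open>x\<close> compares the two halves.\<close>
  let ?es = "filter (\<lambda>a. (a, x) \<in> r) es @ x # filter (\<lambda>a. (a, x) \<notin> r) es"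
  have "sorted_wrt (\<lambda>a b. (a, b) \<in> r) ?es"
    using es insert.prems assms(2)
    by (auto simp: sorted_wrt_append sorted_wrt_filter dest: transD)
  moreover have "distinct ?es" "set ?es = insert x F"
    using es insert.hyps by auto
  ultimately show ?case by blast
qed

lemma funpow_add_apply: "(f ^^ (m + n)) x = (f ^^ n) ((f ^^ m) x)"
  by (metis add.commute comp_apply funpow_add)

section \<open>Heights of vertices, and paths with minimal or maximal beginnings\<close>

definition in_edges :: "'e bratteli \<Rightarrow> nat \<Rightarrow> nat \<Rightarrow> 'e set" where
  "in_edges B n i = {e \<in> edges B n. tgt B e = i}"

text \<open>The number of paths from the root to vertex \<open>i\<close> of level \<open>n\<close>,
  hence an entry of H(n) = P(n)H(1). Summing over edges instead of using matrix entries allows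
  partial sums along the edge order.\<close>

primrec height :: "'e bratteli \<Rightarrow> nat \<Rightarrow> nat \<Rightarrow> nat" where
  "height B 0 i = 1"
| "height B (Suc n) i = (\<Sum>e\<in>in_edges B (Suc n) i. height B n (src B e))"

text \<open>This set and the next are the unions of the bases and of the tops of the
  Kakutani-Rokhlin towers of level \<open>n\<close>. For \<open>n = 0\<close> both are all of
  \<open>paths B\<close>, where the inductions start.\<close>

definition min_upto :: "'e bratteli \<Rightarrow> nat \<Rightarrow> (nat \<Rightarrow> 'e) set" where
  "min_upto B n = {x \<in> paths B. \<forall>i\<in>{1..n}. min_edge B (x i)}"

definition max_upto :: "'e bratteli \<Rightarrow> nat \<Rightarrow> (nat \<Rightarrow> 'e) set" where
  "max_upto B n = {x \<in> paths B. \<forall>i\<in>{1..n}. max_edge B (x i)}"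

lemma paths_edge: "x \<in> paths B \<Longrightarrow> 1 \<le> n \<Longrightarrow> x n \<in> edges B n"
  by (auto simp: paths_def)

lemma paths_step: "x \<in> paths B \<Longrightarrow> 1 \<le> n \<Longrightarrow> tgt B (x n) = src B (x (Suc n))"
  by (auto simp: paths_def)

lemma paths_0: "x \<in> paths B \<Longrightarrow> x 0 = undefined"
  by (auto simp: paths_def PiE_def extensional_def)

section \<open>The order on the edges into one vertex\<close>

locale proper_bratteli =
  fixes B :: "'e bratteli"
  assumes proper: "properly_ordered B"
begin

lemma diagram: "bratteli_diagram B"
  using proper by (auto simp: properly_ordered_def ordered_bratteli_diagram_def)

lemma finite_edges: "1 \<le> n \<Longrightarrow> finite (edges B n)"
  and src_edges: "1 \<le> n \<Longrightarrow> src B ` edges B n = verts B (n - 1)"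
  and tgt_edges: "1 \<le> n \<Longrightarrow> tgt B ` edges B n = verts B n"
  using diagram by (auto simp: bratteli_diagram_def)

lemma all_edgesI: "e \<in> edges B n \<Longrightarrow> 1 \<le> n \<Longrightarrow> e \<in> all_edges B"
  by (auto simp: all_edges_def)

lemma edge_order_partial: "partial_order_on (all_edges B) (edge_order B)"
  using proper by (auto simp: properly_ordered_def ordered_bratteli_diagram_def)

lemma edge_order_trans: "trans (edge_order B)"
  and edge_order_antisym: "antisym (edge_order B)"
  and edge_order_refl: "e \<in> all_edges B \<Longrightarrow> (e, e) \<in> edge_order B"
  and edge_order_subset: "edge_order B \<subseteq> all_edges B \<times> all_edges B"
  using edge_order_partial
  by (auto simp: partial_order_on_def preorder_on_def refl_on_def)

lemma edge_comparable:
  "1 \<le> n \<Longrightarrow> 1 \<le> m \<Longrightarrow> e \<in> edges B n \<Longrightarrow> f \<in> edges B m \<Longrightarrow>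
    (e, f) \<in> edge_order B \<or> (f, e) \<in> edge_order B \<longleftrightarrow> n = m \<and> tgt B e = tgt B f"
  using proper by (auto simp: properly_ordered_def ordered_bratteli_diagram_def)

lemma edge_order_in_edges:
  assumes "(e, f) \<in> edge_order B \<or> (f, e) \<in> edge_order B" "e \<in> in_edges B n i" "1 \<le> n"
  shows "f \<in> in_edges B n i"
proof -
  have "f \<in> all_edges B" using assms(1) edge_order_subset by auto
  then obtain m where m: "1 \<le> m" "f \<in> edges B m" by (auto simp: all_edges_def)
  with edge_comparable[of n m e f] assms show ?thesis by (auto simp: in_edges_def)
qed

lemma finite_in_edges: "1 \<le> n \<Longrightarrow> finite (in_edges B n i)"
  using finite_edges by (auto simp: in_edges_def)

lemma in_edges_nonempty:
  assumes "1 \<le> n" "i \<in> verts B n"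
  shows "in_edges B n i \<noteq> {}"
proof -
  have "i \<in> tgt B ` edges B n" using assms tgt_edges by simp
  then show ?thesis by (auto simp: in_edges_def)
qed

lemma src_in_verts:
  assumes "e \<in> in_edges B (Suc n) i"
  shows "src B e \<in> verts B n"
proof -
  have "src B e \<in> src B ` edges B (Suc n)" using assms by (simp add: in_edges_def)
  then show ?thesis using src_edges[of "Suc n"] by simp
qed

lemma tgt_in_verts:
  assumes "1 \<le> n" "e \<in> edges B n"
  shows "tgt B e \<in> verts B n"
proof -
  have "tgt B e \<in> tgt B ` edges B n" using assms by simp
  then show ?thesis using tgt_edges[OF assms(1)] by simp
qed

lemma ex_out_edge:
  assumes "j \<in> verts B k"
  shows "\<exists>e\<in>edges B (Suc k). src B e = j"
proof -
  have "j \<in> src B ` edges B (Suc k)" using assms src_edges[of "Suc k"] by simp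
  then show ?thesis by auto
qed

lemma verts_nonempty: "verts B n \<noteq> {}"
proof (induction n)
  case 0
  then show ?case by (simp add: verts_def)
next
  case (Suc n)
  then show ?case using ex_out_edge tgt_in_verts[of "Suc n"] by fastforce
qed

lemma sorted_in_edges:
  assumes "1 \<le> n"
  obtains es where "distinct es" "set es = in_edges B n i"
    "sorted_wrt (\<lambda>a b. (a, b) \<in> edge_order B) es"
proof -
  have "(e, f) \<in> edge_order B \<or> (f, e) \<in> edge_order B"
    if "e \<in> in_edges B n i" "f \<in> in_edges B n i" for e f
    using edge_comparable[OF assms assms, of e f] that by (auto simp: in_edges_def)
  then show thesis
    using finite_total_preorder_sorted_list[OF finite_in_edges[OF assms] edge_order_trans] that
    by metis
qed

context
  fixes n i es
  assumes n: "1 \<le> n"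
    and es: "distinct es" "set es = in_edges B n i"
      "sorted_wrt (\<lambda>a b. (a, b) \<in> edge_order B) es"
begin

text \<open>Edges into a vertex are replaced by positions in a list: below, minimal, maximal and
  successor become first, last and next index. An inversion would, by antisymmetry, repeat an entry
  of a distinct list.\<close>

lemma sorted_in_edges_iff:
  assumes "k < length es" "l < length es"
  shows "(es ! k, es ! l) \<in> edge_order B \<longleftrightarrow> k \<le> l"
proof
  assume *: "(es ! k, es ! l) \<in> edge_order B"
  show "k \<le> l"
  proof (rule ccontr)
    assume "\<not> k \<le> l"
    then have "(es ! l, es ! k) \<in> edge_order B"
      using es(3) assms by (auto simp: sorted_wrt_iff_nth_less)
    with * have "es ! l = es ! k" using edge_order_antisym by (auto dest: antisymD)
    with \<open>\<not> k \<le> l\<close> assms es(1) show False by (auto simp: nth_eq_iff_index_eq)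
  qed
next
  have "es ! k \<in> all_edges B"
    using assms(1) es(2) n by (metis (mono_tags, lifting) all_edgesI in_edges_def mem_Collect_eq nth_mem)
  then show "k \<le> l \<Longrightarrow> (es ! k, es ! l) \<in> edge_order B"
    using es(3) assms edge_order_refl by (cases "k = l") (auto simp: sorted_wrt_iff_nth_less)
qed

lemma sorted_in_edges_above:
  assumes "k < length es"
  shows "(es ! k, f) \<in> edge_order B \<longleftrightarrow> (\<exists>l. k \<le> l \<and> l < length es \<and> f = es ! l)"
    and "(f, es ! k) \<in> edge_order B \<longleftrightarrow> (\<exists>l\<le>k. f = es ! l)"
proof -
  have k: "es ! k \<in> in_edges B n i" using assms es(2) nth_mem by blast
  have f: "\<exists>l<length es. f = es ! l" if "(es ! k, f) \<in> edge_order B \<or> (f, es ! k) \<in> edge_order B"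
    using edge_order_in_edges[OF that k n] unfolding es(2)[symmetric] in_set_conv_nth by blast
  show "(es ! k, f) \<in> edge_order B \<longleftrightarrow> (\<exists>l. k \<le> l \<and> l < length es \<and> f = es ! l)"
    using f sorted_in_edges_iff[OF assms] by blast
  show "(f, es ! k) \<in> edge_order B \<longleftrightarrow> (\<exists>l\<le>k. f = es ! l)"
    using f sorted_in_edges_iff[OF _ assms] assms by (metis order.strict_trans1)
qed

lemma sorted_in_edges_all: "k < length es \<Longrightarrow> es ! k \<in> all_edges B"
  using sorted_in_edges_iff[of k k] edge_order_subset by auto

lemma min_edge_nth:
  assumes "k < length es"
  shows "min_edge B (es ! k) \<longleftrightarrow> k = 0"
proof -
  have "min_edge B (es ! k) \<longleftrightarrow> (\<forall>l. l \<le> k \<longrightarrow> es ! l = es ! k)"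
    using sorted_in_edges_all[OF assms] sorted_in_edges_above(2)[OF assms]
    by (auto simp: min_edge_def)
  also have "\<dots> \<longleftrightarrow> (\<forall>l. l \<le> k \<longrightarrow> l = k)"
    using assms es(1) by (simp add: nth_eq_iff_index_eq cong: imp_cong)
  also have "\<dots> \<longleftrightarrow> k = 0" by auto
  finally show ?thesis .
qed

lemma max_edge_nth:
  assumes "k < length es"
  shows "max_edge B (es ! k) \<longleftrightarrow> Suc k = length es"
proof -
  have "max_edge B (es ! k) \<longleftrightarrow> (\<forall>l. k \<le> l \<and> l < length es \<longrightarrow> es ! l = es ! k)"
    using sorted_in_edges_all[OF assms] sorted_in_edges_above(1)[OF assms]
    by (auto simp: max_edge_def)
  also have "\<dots> \<longleftrightarrow> (\<forall>l. k \<le> l \<and> l < length es \<longrightarrow> l = k)"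
    using assms es(1) by (simp add: nth_eq_iff_index_eq cong: imp_cong conj_cong)
  also have "\<dots> \<longleftrightarrow> Suc k = length es"
  proof
    assume *: "\<forall>l. k \<le> l \<and> l < length es \<longrightarrow> l = k"
    show "Suc k = length es"
      using *[rule_format, of "Suc k"] assms by linarith
  qed auto
  finally show ?thesis .
qed

lemma edge_succ_nth:
  "k < length es \<Longrightarrow> edge_succ B (es ! k) f \<longleftrightarrow> Suc k < length es \<and> f = es ! Suc k"
proof 
  assume k: "k < length es" and s: "edge_succ B (es ! k) f"
  then obtain l where l: "k \<le> l" "l < length es" "f = es ! l"
    using sorted_in_edges_above(1)[OF k] unfolding edge_succ_def by blast
  have "k \<noteq> l" using s l(3) unfolding edge_succ_def by blast
  then have Sk: "Suc k \<le> l" using l by simp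
  \<comment> \<open>\<open>es ! Suc k\<close> lies between \<open>es ! k\<close> and its successor
    \<open>f\<close>, so it is one of the two.\<close>
  then have "es ! Suc k = es ! k \<or> es ! Suc k = f"
    using s l k sorted_in_edges_iff[of k "Suc k"] sorted_in_edges_iff[of "Suc k" l]
    unfolding edge_succ_def by simp
  then show "Suc k < length es \<and> f = es ! Suc k"
    using Sk l es(1) k by (simp add: nth_eq_iff_index_eq)
next
  assume k: "k < length es" and f: "Suc k < length es \<and> f = es ! Suc k"
  have "g = es ! k \<or> g = f" if g: "(es ! k, g) \<in> edge_order B" "(g, f) \<in> edge_order B" for g
  proof -
    obtain l where l: "k \<le> l" "l < length es" "g = es ! l"
      using g(1) sorted_in_edges_above(1)[OF k] by blast
    have "l \<le> Suc k" using g(2) f l sorted_in_edges_iff[of l "Suc k"] by simp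
    then show ?thesis using l f by (auto simp: le_Suc_eq)
  qed
  then show "edge_succ B (es ! k) f"
    using es(1) k f sorted_in_edges_iff[of k "Suc k"]
    unfolding edge_succ_def by (simp add: nth_eq_iff_index_eq)
qed

end

lemma in_edges_self: "e \<in> edges B n \<Longrightarrow> e \<in> in_edges B n (tgt B e)"
  by (simp add: in_edges_def)

lemma min_edge_unique:
  assumes n: "1 \<le> n" and "e \<in> in_edges B n i" "f \<in> in_edges B n i" "min_edge B e" "min_edge B f"
  shows "e = f"
proof -
  obtain es where es: "distinct es" "set es = in_edges B n i"
    "sorted_wrt (\<lambda>a b. (a, b) \<in> edge_order B) es"
    using sorted_in_edges[OF n] .
  obtain k l where "k < length es" "e = es ! k" "l < length es" "f = es ! l"
    using assms(2,3) unfolding es(2)[symmetric] in_set_conv_nth by blast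
  then show ?thesis using min_edge_nth[OF n es] assms(4,5) by simp
qed

lemma edge_succ_unique:
  assumes n: "1 \<le> n" and e: "e \<in> edges B n" and "edge_succ B e f" "edge_succ B e g"
  shows "f = g"
proof -
  obtain es where es: "distinct es" "set es = in_edges B n (tgt B e)"
    "sorted_wrt (\<lambda>a b. (a, b) \<in> edge_order B) es"
    using sorted_in_edges[OF n] .
  obtain k where "k < length es" "e = es ! k"
    using in_edges_self[OF e] unfolding es(2)[symmetric] in_set_conv_nth by blast
  then show ?thesis using edge_succ_nth[OF n es] assms(3,4) by simp
qed

lemma ex_min_edge:
  assumes n: "1 \<le> n" and i: "i \<in> verts B n"
  obtains e where "e \<in> in_edges B n i" "min_edge B e"
proof -
  obtain es where es: "distinct es" "set es = in_edges B n i"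
    "sorted_wrt (\<lambda>a b. (a, b) \<in> edge_order B) es"
    using sorted_in_edges[OF n] .
  have "0 < length es" using in_edges_nonempty[OF n i] es(2) by auto
  then show thesis using min_edge_nth[OF n es, of 0] nth_mem es(2) that by blast
qed

lemma ex_edge_succ:
  assumes "1 \<le> n" "e \<in> edges B n" "\<not> max_edge B e"
  obtains f where "f \<in> in_edges B n (tgt B e)" "edge_succ B e f"
proof -
  obtain es where es: "distinct es" "set es = in_edges B n (tgt B e)"
    "sorted_wrt (\<lambda>a b. (a, b) \<in> edge_order B) es"
    using sorted_in_edges[OF assms(1)] .
  obtain k where k: "k < length es" "e = es ! k"
    using in_edges_self[OF assms(2)] es(2) by (metis in_set_conv_nth)
  have "Suc k < length es" using max_edge_nth[OF assms(1) es, of k] assms(3) k by simp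
  then show thesis
    using edge_succ_nth[OF assms(1) es, of k] k es(2) that nth_mem by blast
qed

lemma edge_succ_not_max: "edge_succ B e f \<Longrightarrow> \<not> max_edge B e"
  by (auto simp: edge_succ_def max_edge_def)

section \<open>Prescribed beginnings of paths and the values of the Vershik map\<close>

text \<open>Built downwards from \<open>i\<close>: a minimal edge into the current vertex has a
  source one level lower, where the construction goes on.\<close>

lemma ex_min_prefix:
  assumes "i \<in> verts B n"
  shows "\<exists>p. (\<forall>k\<in>{1..n}. p k \<in> edges B k \<and> min_edge B (p k)) \<and>
    (\<forall>k\<in>{1..<n}. tgt B (p k) = src B (p (Suc k))) \<and> (n \<ge> 1 \<longrightarrow> tgt B (p n) = i)"
  using assms
proof (induction n arbitrary: i)
  case 0
  then show ?case by simp
next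
  case (Suc n)
  obtain e where e: "e \<in> in_edges B (Suc n) i" "min_edge B e"
    using ex_min_edge[OF _ Suc.prems] by auto
  obtain p where p: "\<forall>k\<in>{1..n}. p k \<in> edges B k \<and> min_edge B (p k)"
    "\<forall>k\<in>{1..<n}. tgt B (p k) = src B (p (Suc k))" "n \<ge> 1 \<longrightarrow> tgt B (p n) = src B e"
    using Suc.IH[OF src_in_verts[OF e(1)]] by blast
  have "tgt B ((p(Suc n := e)) k) = src B ((p(Suc n := e)) (Suc k))" if "k \<in> {1..<Suc n}" for k
    using that p(2,3) by (cases "k = n") auto
  moreover have "(p(Suc n := e)) k \<in> edges B k \<and> min_edge B ((p(Suc n := e)) k)"
    if "k \<in> {1..Suc n}" for k
    using that p(1) e by (cases "k = Suc n") (auto simp: in_edges_def)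
  ultimately show ?case
    using e(1) by (intro exI[of _ "p(Suc n := e)"]) (auto simp: in_edges_def)
qed

text \<open>Supplies the candidates for images under the Vershik map: one edge is exchanged for
  another into the same vertex, the tail is kept, and minimal edges are put below.\<close>

lemma ex_path_change:
  assumes x: "x \<in> paths B" and e: "e \<in> in_edges B (Suc n) (tgt B (x (Suc n)))"
  obtains y where "y \<in> min_upto B n" "y (Suc n) = e" "\<And>i. i > Suc n \<Longrightarrow> y i = x i"
proof -
  obtain p where p: "\<forall>k\<in>{1..n}. p k \<in> edges B k \<and> min_edge B (p k)"
    "\<forall>k\<in>{1..<n}. tgt B (p k) = src B (p (Suc k))" "n \<ge> 1 \<longrightarrow> tgt B (p n) = src B e"
    using ex_min_prefix[OF src_in_verts[OF e]] by blast
  \<comment> \<open>The last branch also covers \<open>k = 0\<close>, where a path must have the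
    value \<open>undefined\<close> of \<open>x\<close>.\<close>
  define y where "y k = (if 1 \<le> k \<and> k \<le> n then p k else if k = Suc n then e else x k)" for k
  have "tgt B (y k) = src B (y (Suc k))" if "1 \<le> k" for k
  proof -
    consider "k < n" | "k = n" | "k = Suc n" | "k > Suc n" by linarith
    then show ?thesis
      using that p e paths_step[OF x, of k] by cases (auto simp: y_def in_edges_def)
  qed
  moreover have "y \<in> Pi\<^sub>E {1..} (edges B)"
    using p(1) e paths_edge[OF x] paths_0[OF x]
    by (auto simp: y_def in_edges_def PiE_def extensional_def not_less_eq_eq)
  ultimately have "y \<in> min_upto B n"
    using p(1) by (auto simp: min_upto_def paths_def y_def)
  then show thesis by (rule that) (auto simp: y_def)
qed

text \<open>Downward induction from \<open>k\<close>: equal edges have equal sources, so the edges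
  one level lower end at the same vertex, and a vertex has only one minimal incoming edge.\<close>

lemma min_path_agree:
  assumes "x \<in> paths B" "y \<in> paths B" "1 \<le> k" "x k = y k"
    and "\<And>i. 1 \<le> i \<Longrightarrow> i < k \<Longrightarrow> min_edge B (x i) \<and> min_edge B (y i)"
  shows "1 \<le> i \<Longrightarrow> i \<le> k \<Longrightarrow> x i = y i"
proof (induction "k - i" arbitrary: i)
  case 0
  then show ?case using assms by auto
next
  case (Suc d)
  then have "x (Suc i) = y (Suc i)" by auto
  then have "tgt B (x i) = tgt B (y i)"
    using paths_step assms(1,2) Suc.prems by metis
  then show ?case
    using min_edge_unique[of i "x i" "tgt B (x i)" "y i"] Suc assms paths_edge[of _ B i]
    by (auto simp: in_edges_def)
qed

text \<open>Trades the definite description in \<open>vershik\<close> for a check on a given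
  candidate; level \<open>n + 1\<close> is the first at which \<open>x\<close> is not
  maximal.\<close>

lemma vershik_eqI:
  assumes x: "x \<in> max_upto B n" and y: "y \<in> min_upto B n"
    and s: "edge_succ B (x (Suc n)) (y (Suc n))" and tail: "\<And>i. i > Suc n \<Longrightarrow> y i = x i"
  shows "vershik B x = y"
proof -
  have xp: "x \<in> paths B" and yp: "y \<in> paths B"
    using x y by (auto simp: max_upto_def min_upto_def)
  have nm: "\<not> max_edge B (x (Suc n))" using s by (rule edge_succ_not_max)
  then have "\<not> max_path B x" by (auto simp: max_path_def)
  moreover have "(LEAST k. 1 \<le> k \<and> \<not> max_edge B (x k)) = Suc n"
  proof (rule Least_equality)
    show "Suc n \<le> k" if "1 \<le> k \<and> \<not> max_edge B (x k)" for k
      using that x by (intro not_less_eq_eq[THEN iffD1] notI) (auto simp: max_upto_def)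
  qed (use nm in simp)
  moreover have "(THE z. z \<in> paths B \<and> (\<forall>i\<in>{1..<Suc n}. min_edge B (z i)) \<and>
      edge_succ B (x (Suc n)) (z (Suc n)) \<and> (\<forall>i>Suc n. z i = x i)) = y"
  proof (rule the_equality)
    show "y \<in> paths B \<and> (\<forall>i\<in>{1..<Suc n}. min_edge B (y i)) \<and>
      edge_succ B (x (Suc n)) (y (Suc n)) \<and> (\<forall>i>Suc n. y i = x i)"
      using y s tail by (auto simp: min_upto_def)
  next
    fix z assume z: "z \<in> paths B \<and> (\<forall>i\<in>{1..<Suc n}. min_edge B (z i)) \<and>
      edge_succ B (x (Suc n)) (z (Suc n)) \<and> (\<forall>i>Suc n. z i = x i)"
    \<comment> \<open>Uniqueness of the successor settles level \<open>n + 1\<close>; the minimal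
      edges below are then forced.\<close>
    then have "z (Suc n) = y (Suc n)"
      using edge_succ_unique[of "Suc n" "x (Suc n)"] s paths_edge[OF xp] by auto
    then have *: "z i = y i" if "1 \<le> i" "i \<le> Suc n" for i
      using min_path_agree[of z y "Suc n" i] z y yp that by (auto simp: min_upto_def)
    show "z = y"
    proof
      fix i
      consider "i = 0" | "1 \<le> i \<and> i \<le> Suc n" | "i > Suc n" by linarith
      then show "z i = y i"
        using * z tail paths_0[of z B] paths_0[OF yp] by cases auto
    qed
  qed
  ultimately show ?thesis by (simp add: vershik_def Let_def)
qed

text \<open>Tops are mapped into bases. The maximal path goes to the minimal one; otherwise the
  first non-maximal edge lies above level \<open>n\<close>, and all edges below it become
  minimal.\<close>

lemma vershik_max_upto:
  assumes x: "x \<in> max_upto B n"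
  shows "vershik B x \<in> min_upto B n"
proof (cases "max_path B x")
  case True
  then have "vershik B x = (THE y. min_path B y)" by (simp add: vershik_def)
  moreover have "min_path B (THE y. min_path B y)"
    using proper theI'[of "min_path B"] by (simp add: properly_ordered_def)
  ultimately have "min_path B (vershik B x)" by simp
  then show ?thesis by (simp add: min_path_def min_upto_def)
next
  case False
  define k where "k = (LEAST k. 1 \<le> k \<and> \<not> max_edge B (x k))"
  have xp: "x \<in> paths B" using x by (auto simp: max_upto_def)
  have ex: "\<exists>k. 1 \<le> k \<and> \<not> max_edge B (x k)" using False xp unfolding max_path_def by blast
  have k: "1 \<le> k" "\<not> max_edge B (x k)"
    using LeastI_ex[OF ex] by (simp_all add: k_def)
  have less: "max_edge B (x i)" if "1 \<le> i" "i < k" for i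
    using not_less_Least[of i "\<lambda>k. 1 \<le> k \<and> \<not> max_edge B (x k)"] that unfolding k_def by blast
  have "\<not> k \<le> n"
  proof
    assume "k \<le> n"
    then show False using k x by (simp add: max_upto_def)
  qed
  then obtain j where j: "k = Suc j" "n \<le> j"
    using k(1) by (cases k) simp_all
  obtain e where e: "e \<in> in_edges B k (tgt B (x k))" "edge_succ B (x k) e"
    using ex_edge_succ[OF k(1) paths_edge[OF xp k(1)] k(2)] .
  obtain y where y: "y \<in> min_upto B j" "y (Suc j) = e" "\<And>i. i > Suc j \<Longrightarrow> y i = x i"
    using ex_path_change[OF xp e(1)[unfolded j(1)]] by metis
  have "vershik B x = y"
  proof (rule vershik_eqI[OF _ y(1) _ y(3)])
    show "x \<in> max_upto B j" using less xp by (simp add: max_upto_def j(1))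
    show "edge_succ B (x (Suc j)) (y (Suc j))" using e(2) y(2) by (simp add: j(1))
  qed
  then show ?thesis using y j by (auto simp: min_upto_def)
qed

lemma vershik_paths: "x \<in> paths B \<Longrightarrow> vershik B x \<in> paths B"
  using vershik_max_upto[of x 0] by (auto simp: max_upto_def min_upto_def)

lemma vershik_funpow_paths: "x \<in> paths B \<Longrightarrow> (vershik B ^^ s) x \<in> paths B"
  by (induction s) (auto intro: vershik_paths)

section \<open>Return times to the bases of the towers\<close>

text \<open>A path starting with the first edge of \<open>es\<close> passes through the edges in
  order: crossing the tower over the source of \<open>es ! l\<close> takes its height in steps and
  leads to \<open>es ! Suc l\<close> with a minimal prefix. The assumption \<open>IH\<close> is
  \<open>climb\<close> at level \<open>n\<close>; ending in \<open>vershik B y\<close> with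
  \<open>y\<close> in the top avoids the subtraction of 1 from the height.\<close>

lemma climb_edges:
  assumes IH: "\<And>x. x \<in> min_upto B n \<Longrightarrow>
      \<exists>y\<in>max_upto B n. (\<forall>i>n. y i = x i) \<and>
        (vershik B ^^ height B n (src B (x (Suc n)))) x = vershik B y"
    and es: "distinct es" "set es = in_edges B (Suc n) (tgt B (x (Suc n)))"
      "sorted_wrt (\<lambda>a b. (a, b) \<in> edge_order B) es"
    and x: "x \<in> min_upto B (Suc n)" and l: "l < length es"
  shows "\<exists>y\<in>min_upto B n. y (Suc n) = es ! l \<and> (\<forall>i>Suc n. y i = x i) \<and>
    (vershik B ^^ (\<Sum>k<l. height B n (src B (es ! k)))) x = y"
  using l
proof (induction l)
  case 0
  have xp: "x \<in> paths B" using x by (auto simp: min_upto_def)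
  have "x (Suc n) = es ! 0"
    using min_edge_unique[of "Suc n" "x (Suc n)" "tgt B (x (Suc n))" "es ! 0"] x min_edge_nth[OF _ es 0] 0 es(2)
      nth_mem[OF 0] in_edges_self[OF paths_edge[OF xp]]
    by (auto simp: min_upto_def)
  then show ?case using x by (intro bexI[of _ x]) (auto simp: min_upto_def)
next
  case (Suc l)
  have xp: "x \<in> paths B" using x by (auto simp: min_upto_def)
  obtain y where y: "y \<in> min_upto B n" "y (Suc n) = es ! l" "\<forall>i>Suc n. y i = x i"
    "(vershik B ^^ (\<Sum>k<l. height B n (src B (es ! k)))) x = y"
    using Suc by auto
  obtain z where z: "z \<in> max_upto B n" "\<forall>i>n. z i = y i"
    "(vershik B ^^ height B n (src B (y (Suc n)))) y = vershik B z"
    using IH[OF y(1)] by auto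
  have "es ! Suc l \<in> in_edges B (Suc n) (tgt B (x (Suc n)))"
    using Suc.prems es(2) nth_mem by blast
  then obtain u where u: "u \<in> min_upto B n" "u (Suc n) = es ! Suc l" "\<And>i. i > Suc n \<Longrightarrow> u i = x i"
    using ex_path_change[OF xp] by metis
  \<comment> \<open>\<open>z\<close> is in the top of its tower and still has the edge
    \<open>es ! l\<close>, so the Vershik map moves it to the next edge.\<close>
  have "vershik B z = u"
  proof (rule vershik_eqI[OF z(1) u(1)])
    show "edge_succ B (z (Suc n)) (u (Suc n))"
      using edge_succ_nth[OF _ es, of l] Suc.prems z(2) y(2) u(2) by simp
    show "u i = z i" if "i > Suc n" for i
      using that z(2) y(3) u(3) by simp
  qed
  then have "(vershik B ^^ (\<Sum>k<Suc l. height B n (src B (es ! k)))) x = u"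
    using y(2,4) z(3) by (simp add: funpow_add_apply)
  then show ?case using u by blast
qed

lemma sum_sorted_in_edges:
  assumes "distinct es" "set es = in_edges B n i"
  shows "(\<Sum>k<length es. F (es ! k)) = (\<Sum>e\<in>in_edges B n i. F e)"
  using sum.reindex_bij_betw[OF bij_betw_nth[OF assms(1) refl assms(2)[symmetric]], of F] by simp

text \<open>The vertex of \<open>x\<close> at level \<open>n\<close> is written \<open>src B (x (Suc n))\<close>, which makes sense for \<open>n = 0\<close> too.\<close>

lemma climb:
  "x \<in> min_upto B n \<Longrightarrow> \<exists>y\<in>max_upto B n. (\<forall>i>n. y i = x i) \<and>
    (vershik B ^^ height B n (src B (x (Suc n)))) x = vershik B y"
proof (induction n arbitrary: x)
  case 0
  \<comment> \<open>The height at level 0 is 1, so \<open>y = x\<close> works.\<close>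
  then show ?case by (intro bexI[of _ x]) (auto simp: min_upto_def max_upto_def)
next
  case (Suc n)
  have xp: "x \<in> paths B" using Suc.prems by (auto simp: min_upto_def)
  obtain es where es: "distinct es" "set es = in_edges B (Suc n) (tgt B (x (Suc n)))"
      "sorted_wrt (\<lambda>a b. (a, b) \<in> edge_order B) es"
    using sorted_in_edges[of "Suc n"] by auto
  have "es \<noteq> []" using in_edges_self[OF paths_edge[OF xp], of "Suc n"] es(2) by auto
  \<comment> \<open>\<open>l\<close> is the last position. After reaching it, one more crossing at
    level \<open>n\<close> gives a path that is maximal at level \<open>n + 1\<close> as
    well.\<close>
  then obtain l where l: "length es = Suc l" by (cases es) auto
  obtain y where y: "y \<in> min_upto B n" "y (Suc n) = es ! l" "\<forall>i>Suc n. y i = x i"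
    "(vershik B ^^ (\<Sum>k<l. height B n (src B (es ! k)))) x = y"
    using climb_edges[OF Suc.IH es Suc.prems, of l] l by auto
  obtain z where z: "z \<in> max_upto B n" "\<forall>i>n. z i = y i"
    "(vershik B ^^ height B n (src B (y (Suc n)))) y = vershik B z"
    using Suc.IH[OF y(1)] by auto
  have "max_edge B (z (Suc n))" using z(2) y(2) max_edge_nth[OF _ es, of l] l by simp
  then have "z \<in> max_upto B (Suc n)" using z(1) by (auto simp: max_upto_def le_Suc_eq)
  moreover have "height B (Suc n) (src B (x (Suc (Suc n)))) = (\<Sum>k<Suc l. height B n (src B (es ! k)))"
    using sum_sorted_in_edges[OF es(1,2), of "\<lambda>e. height B n (src B e)"] l paths_step[OF xp, of "Suc n"]
    by simp
  then have "(vershik B ^^ height B (Suc n) (src B (x (Suc (Suc n))))) x = vershik B z"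
    using y(2,4) z(2,3) by (simp add: funpow_add_apply del: height.simps)
  moreover have "\<forall>i>Suc n. z i = x i" using y(3) z(2) by simp
  ultimately show ?case by blast
qed

text \<open>The first of the two kinds of return times to which the eigenvalue is applied; the
  second, partial sums of heights, follows.\<close>

lemma return_height:
  assumes "x \<in> min_upto B n"
  shows "(vershik B ^^ height B n (src B (x (Suc n)))) x \<in> min_upto B n"
  using climb[OF assms] vershik_max_upto by auto

lemma return_partial:
  assumes "distinct es" "set es = in_edges B (Suc n) (tgt B (x (Suc n)))"
      "sorted_wrt (\<lambda>a b. (a, b) \<in> edge_order B) es"
    and "x \<in> min_upto B (Suc n)" "l < length es"
  shows "(vershik B ^^ (\<Sum>k<l. height B n (src B (es ! k)))) x \<in> min_upto B n"
  using climb_edges[OF climb assms] by auto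

text \<open>Provides, for each vertex, a path whose return times can be examined: a minimal prefix
  ending there, prolonged by edges chosen one after another.\<close>

lemma ex_min_upto:
  assumes "i \<in> verts B n" "1 \<le> n"
  obtains x where "x \<in> min_upto B n" "tgt B (x n) = i"
proof -
  obtain p where p: "\<forall>k\<in>{1..n}. p k \<in> edges B k \<and> min_edge B (p k)"
    "\<forall>k\<in>{1..<n}. tgt B (p k) = src B (p (Suc k))" "tgt B (p n) = i"
    using ex_min_prefix[OF assms(1)] assms(2) by blast
  obtain f where f: "\<And>k. f k \<in> edges B (Suc (n + k)) \<and> (k = 0 \<longrightarrow> src B (f k) = i)"
    "\<And>k. src B (f (Suc k)) = tgt B (f k)"
  proof (rule exE[OF dependent_nat_choice[of "\<lambda>k e. e \<in> edges B (Suc (n + k)) \<and> (k = 0 \<longrightarrow> src B e = i)"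
        "\<lambda>k e e'. src B e' = tgt B e"]])
    show "\<exists>e. e \<in> edges B (Suc (n + 0)) \<and> (0 = 0 \<longrightarrow> src B e = i)"
      using ex_out_edge[OF assms(1)] by auto
    show "\<exists>e'. (e' \<in> edges B (Suc (n + Suc k)) \<and> (Suc k = 0 \<longrightarrow> src B e' = i)) \<and> src B e' = tgt B e"
      if "e \<in> edges B (Suc (n + k)) \<and> (k = 0 \<longrightarrow> src B e = i)" for e k
      using ex_out_edge[OF tgt_in_verts[of "Suc (n + k)" e]] that by auto
  qed auto
  \<comment> \<open>\<open>f k\<close> is an edge of level \<open>n + k + 1\<close>, hence the shift
    by \<open>Suc n\<close>.\<close>
  define x where "x k = (if k = 0 then undefined else if k \<le> n then p k else f (k - Suc n))" for k
  have "x k \<in> edges B k" if "1 \<le> k" for k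
    using p(1) f(1)[of "k - Suc n"] that by (auto simp: x_def)
  moreover have "tgt B (x k) = src B (x (Suc k))" if "1 \<le> k" for k
  proof -
    consider "k < n" | "k = n" | "k > n" by linarith
    then show ?thesis
    proof cases
      case 3
      then show ?thesis using f(2)[of "k - Suc n"] by (simp add: x_def Suc_diff_Suc)
    qed (use p f(1)[of 0] that in \<open>auto simp: x_def\<close>)
  qed
  ultimately have "x \<in> paths B"
    by (auto simp: paths_def PiE_def extensional_def x_def)
  then show thesis
    using p assms(2) by (intro that[of x]) (auto simp: min_upto_def x_def)
qed

section \<open>Topology of the path space and the eigenfunction near the minimal path\<close>

lemma topspace_path_space: "topspace (path_space B) = paths B"
proof -
  have "x \<in> cylinder B 1 x" if "x \<in> paths B" for x
    using that by (simp add: cylinder_def)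
  then show ?thesis
    unfolding path_space_def topology_generated_by_topspace by (auto simp: cylinder_def)
qed

lemma openin_cylinder: "1 \<le> n \<Longrightarrow> e \<in> paths B \<Longrightarrow> openin (path_space B) (cylinder B n e)"
  unfolding path_space_def by (intro topology_generated_by_Basis) auto

text \<open>Since the minimal path is unique, \<open>U\<close> and the open complements of the sets
  \<open>min_upto B n\<close> cover the space. These complements increase with \<open>n\<close>, so
  a finite subcover yields \<open>N\<close>.\<close>

lemma min_upto_shrinks:
  assumes compact: "compact_space (path_space B)"
    and U: "openin (path_space B) U" "x0 \<in> U" and x0: "min_path B x0"
  shows "\<exists>N. \<forall>n\<ge>N. min_upto B n \<subseteq> U"
proof -
  define C where "C n = paths B - min_upto B n" for n
  have open_C: "openin (path_space B) (C n)" for n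
  proof (subst openin_subopen, intro ballI)
    fix x assume x: "x \<in> C n"
    \<comment> \<open>The basic cylinders have length at least 1, while \<open>n\<close> may be
      0.\<close>
    have "cylinder B (max 1 n) x \<subseteq> C n"
    proof
      fix y assume y: "y \<in> cylinder B (max 1 n) x"
      obtain i where "i \<in> {1..n}" "\<not> min_edge B (x i)"
        using x by (auto simp: C_def min_upto_def)
      then show "y \<in> C n" using y by (auto simp: C_def min_upto_def cylinder_def)
    qed
    moreover have "openin (path_space B) (cylinder B (max 1 n) x)"
      using x openin_cylinder[of "max 1 n" x] by (simp add: C_def)
    moreover have "x \<in> cylinder B (max 1 n) x" using x by (simp add: C_def cylinder_def)
    ultimately show "\<exists>T. openin (path_space B) T \<and> x \<in> T \<and> T \<subseteq> C n" by blast
  qed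
  have "x \<in> U \<union> (\<Union>n. C n)" if x: "x \<in> paths B" for x
  proof (cases "x = x0")
    case False
    have "\<exists>!z. min_path B z" using proper by (simp add: properly_ordered_def)
    then have "\<not> min_path B x" using False x0 by blast
    then obtain n where "1 \<le> n" "\<not> min_edge B (x n)" using x by (auto simp: min_path_def)
    then have "x \<in> C n" using x by (auto simp: C_def min_upto_def)
    then show ?thesis by blast
  qed (use U in simp)
  then have "topspace (path_space B) \<subseteq> \<Union> (insert U (range C))"
    unfolding topspace_path_space by auto
  moreover have "\<forall>W\<in>insert U (range C). openin (path_space B) W" using U open_C by auto
  ultimately obtain F where F: "finite F" "F \<subseteq> insert U (range C)" "topspace (path_space B) \<subseteq> \<Union>F"
    using compact unfolding compact_space_alt by meson
  obtain J where J: "finite J" "F - {U} = C ` J"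
    using finite_subset_image[of "F - {U}" C UNIV] F by blast
  have "min_upto B n \<subseteq> U" if n: "n \<ge> Max (insert 0 J)" for n
  proof
    fix x assume x: "x \<in> min_upto B n"
    have "x \<notin> C j" if "j \<in> J" for j
    proof -
      have "j \<le> n" using that n J(1) by simp
      then show ?thesis using x by (auto simp: C_def min_upto_def)
    qed
    moreover have "x \<in> \<Union>F" using F(3) x by (auto simp: topspace_path_space min_upto_def)
    ultimately show "x \<in> U" using J(2) by blast
  qed
  then show ?thesis by blast
qed

text \<open>By the eigenvalue equation, (lam^s - 1) g(x) is the change of \<open>g\<close> between a
  point and its return. Both points are near \<open>x0\<close>, where \<open>g\<close> is almost
  constant and bounded away from 0.\<close>

lemma eigenvalue_power_return:
  fixes g :: "(nat \<Rightarrow> 'e) \<Rightarrow> complex"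
  assumes compact: "compact_space (path_space B)"
    and cont: "continuous_map (path_space B) euclidean g"
    and eigen: "\<And>x. x \<in> paths B \<Longrightarrow> g (vershik B x) = lam * g x"
    and x0: "min_path B x0" "g x0 \<noteq> 0" and "\<delta> > 0"
  shows "\<exists>N. \<forall>n\<ge>N. \<forall>x s. x \<in> min_upto B n \<longrightarrow> (vershik B ^^ s) x \<in> min_upto B n \<longrightarrow>
    norm (lam ^ s - 1) < \<delta>"
proof -
  define c where "c = norm (g x0)"
  \<comment> \<open>The bound \<open>c / 2\<close> keeps |g(x)| above \<open>c / 2\<close>; with the
    other bound, two distances \<open>d\<close> add up to at most
    \<open>\<delta> * (c / 2)\<close>.\<close>
  define d where "d = min (c / 2) (\<delta> * c / 4)"
  have c: "c > 0" using x0 by (simp add: c_def)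
  then have d: "d > 0" "d \<le> c / 2" "d \<le> \<delta> * c / 4" using \<open>\<delta> > 0\<close> by (auto simp: d_def)
  define U where "U = {x \<in> topspace (path_space B). g x \<in> ball (g x0) d}"
  have "openin (path_space B) U"
    unfolding U_def by (rule openin_continuous_map_preimage[OF cont]) simp
  moreover have "x0 \<in> U" using x0 d by (auto simp: U_def topspace_path_space min_path_def)
  ultimately obtain N where N: "\<And>n. n \<ge> N \<Longrightarrow> min_upto B n \<subseteq> U"
    using min_upto_shrinks[OF compact _ _ x0(1)] by blast
  have "norm (lam ^ s - 1) < \<delta>"
    if n: "n \<ge> N" and x: "x \<in> min_upto B n" "(vershik B ^^ s) x \<in> min_upto B n" for n x s
  proof -
    have xp: "x \<in> paths B" using x by (simp add: min_upto_def)
    have "g ((vershik B ^^ s) x) = lam ^ s * g x"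
      by (induction s) (simp_all add: eigen vershik_funpow_paths[OF xp])
    then have eq: "(lam ^ s - 1) * g x = g ((vershik B ^^ s) x) - g x" by (simp add: algebra_simps)
    have gx: "dist (g x0) (g x) < d" and gy: "dist (g x0) (g ((vershik B ^^ s) x)) < d"
      using N[OF n] x by (auto simp: U_def)
    have "norm (g x) > c / 2"
      using gx d norm_triangle_ineq2[of "g x0" "g x"] by (simp add: c_def dist_norm)
    then have "norm (lam ^ s - 1) * (c / 2) \<le> norm (lam ^ s - 1) * norm (g x)"
      by (intro mult_left_mono) auto
    also have "\<dots> = dist (g ((vershik B ^^ s) x)) (g x)"
      by (simp add: dist_norm eq flip: norm_mult)
    also have "\<dots> < d + d" using dist_triangle3[of "g ((vershik B ^^ s) x)" "g x" "g x0"] gx gy by linarith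
    also have "\<dots> \<le> \<delta> * (c / 2)" using d by simp
    finally show ?thesis using c by simp
  qed
  then show ?thesis by blast
qed

section \<open>Incidence matrices as sums over edges\<close>

lemma incidence_mult_vec:
  assumes "1 \<le> n"
  shows "incidence B (Suc n) *\<^sub>v Matrix.vec (nverts B n) (\<lambda>j. u (Suc j)) =
    Matrix.vec (nverts B (Suc n)) (\<lambda>i. \<Sum>e\<in>in_edges B (Suc n) (Suc i). u (src B e))"
proof (rule eq_vecI)
  fix i assume i: "i < dim_vec (Matrix.vec (nverts B (Suc n)) (\<lambda>i. \<Sum>e\<in>in_edges B (Suc n) (Suc i). u (src B e)))"
  let ?E = "in_edges B (Suc n) (Suc i)"
  have src: "src B e \<in> {1..nverts B n}" if "e \<in> ?E" for e
    using src_in_verts[OF that] assms by (simp add: verts_def)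
  have "(incidence B (Suc n) *\<^sub>v Matrix.vec (nverts B n) (\<lambda>j. u (Suc j))) $ i =
      (\<Sum>j<nverts B n. of_nat (card {e \<in> edges B (Suc n). src B e = Suc j \<and> tgt B e = Suc i}) * u (Suc j))"
    using i by (simp add: incidence_def scalar_prod_def atLeast0LessThan)
  \<comment> \<open>Edges are grouped by source. Sources at level \<open>n \<ge> 1\<close> are at
    least 1, so the truncated subtraction is exact.\<close>
  also have "\<dots> = (\<Sum>j<nverts B n. \<Sum>e\<in>{e \<in> ?E. src B e - 1 = j}. u (src B e))"
  proof (rule sum.cong[OF refl])
    fix j
    have "{e \<in> edges B (Suc n). src B e = Suc j \<and> tgt B e = Suc i} = {e \<in> ?E. src B e - 1 = j}"
      using src by (force simp: in_edges_def)
    moreover have "(\<Sum>e\<in>{e \<in> ?E. src B e - 1 = j}. u (src B e)) = (\<Sum>e\<in>{e \<in> ?E. src B e - 1 = j}. u (Suc j))"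
      using src by (intro sum.cong refl) fastforce
    ultimately show "of_nat (card {e \<in> edges B (Suc n). src B e = Suc j \<and> tgt B e = Suc i}) * u (Suc j) =
        (\<Sum>e\<in>{e \<in> ?E. src B e - 1 = j}. u (src B e))" by simp
  qed
  also have "\<dots> = (\<Sum>e\<in>?E. u (src B e))"
  proof (rule sum.group)
    show "(\<lambda>e. src B e - 1) ` ?E \<subseteq> {..<nverts B n}" using src by fastforce
  qed (simp_all add: finite_in_edges)
  finally show "(incidence B (Suc n) *\<^sub>v Matrix.vec (nverts B n) (\<lambda>j. u (Suc j))) $ i =
      Matrix.vec (nverts B (Suc n)) (\<lambda>i. \<Sum>e\<in>in_edges B (Suc n) (Suc i). u (src B e)) $ i"
    using i by simp
qed (simp add: incidence_def)

lemma inc_prod_carrier: "m \<le> n \<Longrightarrow> inc_prod B n m \<in> carrier_mat (nverts B n) (nverts B m)"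
proof (induction n)
  case (Suc n)
  then show ?case by (cases "m = Suc n") (auto simp: incidence_def)
qed simp

text \<open>Serves twice: for the heights from level 1 on, and for the rounding errors from the
  level where they begin to satisfy the recursion.\<close>

lemma inc_prod_mult_vec:
  assumes m: "1 \<le> m" "m \<le> n"
    and step: "\<And>k i. m \<le> k \<Longrightarrow> i \<in> verts B (Suc k) \<Longrightarrow>
      u (Suc k) i = (\<Sum>e\<in>in_edges B (Suc k) i. u k (src B e))"
  shows "inc_prod B n m *\<^sub>v Matrix.vec (nverts B m) (\<lambda>j. u m (Suc j)) = Matrix.vec (nverts B n) (\<lambda>j. u n (Suc j))"
  using m(2)
proof (induction n rule: dec_induct)
  case base
  have "inc_prod B m m = 1\<^sub>m (nverts B m)" by (cases m) auto
  then show ?case by simp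
next
  case (step n)
  have "inc_prod B (Suc n) m *\<^sub>v Matrix.vec (nverts B m) (\<lambda>j. u m (Suc j)) =
      incidence B (Suc n) *\<^sub>v (inc_prod B n m *\<^sub>v Matrix.vec (nverts B m) (\<lambda>j. u m (Suc j)))"
    using inc_prod_carrier[OF step(1)] step(1)
    by (simp add: assoc_mult_mat_vec[of _ "nverts B (Suc n)" "nverts B n" _ "nverts B m"] incidence_def)
  also have "\<dots> = Matrix.vec (nverts B (Suc n)) (\<lambda>i. \<Sum>e\<in>in_edges B (Suc n) (Suc i). u n (src B e))"
    using step(3) incidence_mult_vec[of n "u n"] m(1) step(1) by simp
  also have "\<dots> = Matrix.vec (nverts B (Suc n)) (\<lambda>j. u (Suc n) (Suc j))"
    using assms(3)[OF step(1)] by (intro eq_vecI) (simp_all add: verts_def)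
  finally show ?case .
qed

end

section \<open>Closeness to integers\<close>

text \<open>\<open>Ln\<close> is continuous at 1, and at the given exponential it differs from the
  exponent by a multiple of 2 pi i, so its modulus is 2 pi times the distance of \<theta> from some
  integer.\<close>

lemma exp_near_one_imp_near_int:
  fixes \<epsilon> :: real
  assumes "\<epsilon> > 0"
  shows "\<exists>\<delta>>0. \<forall>\<theta>::real. norm (exp (2 * \<i> * of_real pi * of_real \<theta>) - 1) < \<delta> \<longrightarrow>
    (\<exists>k::int. \<bar>\<theta> - of_int k\<bar> < \<epsilon>)"
proof -
  have "isCont Ln 1" by (rule continuous_at_Ln) simp
  then obtain \<delta> where \<delta>: "\<delta> > 0" "\<And>z. dist z 1 < \<delta> \<Longrightarrow> dist (Ln z) (Ln 1) < 2 * pi * \<epsilon>"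
    using assms unfolding continuous_at_eps_delta by (metis mult_pos_pos pi_gt_zero zero_less_numeral)
  have "\<exists>k::int. \<bar>\<theta> - of_int k\<bar> < \<epsilon>"
    if "norm (exp (2 * \<i> * of_real pi * of_real \<theta>) - 1) < \<delta>" for \<theta> :: real
  proof -
    define z where "z = exp (2 * \<i> * of_real pi * of_real \<theta> :: complex)"
    have "exp (Ln z) = exp (2 * \<i> * of_real pi * of_real \<theta>)" by (simp add: z_def)
    then obtain k :: int where "Ln z = 2 * \<i> * of_real pi * of_real \<theta> + (of_int (2 * k) * pi) * \<i>"
      unfolding exp_eq by blast
    then have "Ln z = of_real (2 * pi * (\<theta> + of_int k)) * \<i>"
      by (simp add: algebra_simps)
    then have "norm (Ln z) = 2 * pi * \<bar>\<theta> + of_int k\<bar>"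
      by (simp add: norm_mult abs_mult del: of_real_mult of_real_add)
    moreover have "norm (Ln z) < 2 * pi * \<epsilon>"
      using \<delta>(2)[of z] that by (simp add: z_def dist_norm)
    ultimately show ?thesis by (intro exI[of _ "-k"]) simp
  qed
  with \<delta>(1) show ?thesis by blast
qed

text \<open>Steps of size less than \<open>1 - 2 \<epsilon>\<close> cannot carry a sum from the neighbourhood of one integer
  to that of the next.\<close>

lemma partial_sums_near_zero:
  fixes a :: "nat \<Rightarrow> real"
  assumes step: "\<And>k. k < L \<Longrightarrow> \<bar>a k\<bar> < \<epsilon>"
    and near: "\<And>l. l < L \<Longrightarrow> \<exists>z::int. \<bar>(\<Sum>k<l. a k) - of_int z\<bar> < \<epsilon>"
    and eps: "0 < \<epsilon>" "\<epsilon> \<le> 1 / 4"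
  shows "l < L \<Longrightarrow> \<bar>\<Sum>k<l. a k\<bar> < \<epsilon>"
proof (induction l)
  case 0
  then show ?case using eps by simp
next
  case (Suc l)
  obtain z :: int where z: "\<bar>(\<Sum>k<Suc l. a k) - of_int z\<bar> < \<epsilon>" using near Suc.prems by blast
  \<comment> \<open>One step from the induction hypothesis; so |z| is less than 3 \<epsilon>, which
    is at most 3/4.\<close>
  have "\<bar>\<Sum>k<Suc l. a k\<bar> < 2 * \<epsilon>" using Suc step[of l] by simp
  with z eps have "\<bar>of_int z :: real\<bar> < 1" by linarith
  then have "z = 0" by linarith
  then show ?case using z by simp
qed

lemma max_norm_less:
  assumes "0 < dim_vec v" and "\<And>i. i < dim_vec v \<Longrightarrow> \<bar>v $ i\<bar> < \<epsilon>"
  shows "\<bar>max_norm v\<bar> < \<epsilon>"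
proof -
  have "max_norm v \<in> (\<lambda>i. \<bar>v $ i\<bar>) ` {..<dim_vec v}"
    unfolding max_norm_def using assms(1) by (intro Max_in) auto
  then show ?thesis using assms(2) by auto
qed

section \<open>The rounding errors of \<alpha> H(n) and their recursion\<close>

context proper_bratteli
begin

text \<open>Collects what the return times of level \<open>n\<close> give. The sums with
  \<open>l < length es\<close> omit the last edge; the complete sum is a height of level
  \<open>n + 1\<close> and is treated there.\<close>

definition near_int_at :: "real \<Rightarrow> real \<Rightarrow> nat \<Rightarrow> bool" where
  "near_int_at \<alpha> \<epsilon> n \<longleftrightarrow>
    (\<forall>j\<in>verts B n. \<exists>z::int. \<bar>\<alpha> * real (height B n j) - of_int z\<bar> < \<epsilon>) \<and>
    (\<forall>i\<in>verts B (Suc n). \<forall>es. distinct es \<longrightarrow> set es = in_edges B (Suc n) i \<longrightarrow>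
      sorted_wrt (\<lambda>a b. (a, b) \<in> edge_order B) es \<longrightarrow>
      (\<forall>l<length es. \<exists>z::int. \<bar>\<alpha> * real (\<Sum>k<l. height B n (src B (es ! k))) - of_int z\<bar> < \<epsilon>))"

lemma eigenvalue_near_int:
  fixes g :: "(nat \<Rightarrow> 'e) \<Rightarrow> complex"
  assumes compact: "compact_space (path_space B)"
    and cont: "continuous_map (path_space B) euclidean g"
    and eigen: "\<And>x. x \<in> paths B \<Longrightarrow>
      g (vershik B x) = exp (2 * \<i> * of_real pi * of_real \<alpha>) * g x"
    and x0: "min_path B x0" "g x0 \<noteq> 0" and eps: "\<epsilon> > 0"
  shows "\<exists>N\<ge>1. \<forall>n\<ge>N. near_int_at \<alpha> \<epsilon> n"
proof -
  obtain \<delta> where \<delta>: "\<delta> > 0" "\<And>\<theta>::real. norm (exp (2 * \<i> * of_real pi * of_real \<theta>) - 1) < \<delta> \<Longrightarrow>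
      (\<exists>k::int. \<bar>\<theta> - of_int k\<bar> < \<epsilon>)"
    using exp_near_one_imp_near_int[OF eps] by blast
  obtain N where N: "\<And>n x s. n \<ge> N \<Longrightarrow> x \<in> min_upto B n \<Longrightarrow> (vershik B ^^ s) x \<in> min_upto B n \<Longrightarrow>
      norm (exp (2 * \<i> * of_real pi * of_real \<alpha>) ^ s - 1 :: complex) < \<delta>"
    using eigenvalue_power_return[OF compact cont eigen x0 \<delta>(1)] by blast
  have near: "\<exists>z::int. \<bar>\<alpha> * real s - of_int z\<bar> < \<epsilon>"
    if "n \<ge> N" "x \<in> min_upto B n" "(vershik B ^^ s) x \<in> min_upto B n" for n x s
  proof (rule \<delta>(2))
    have "exp (2 * \<i> * of_real pi * of_real (\<alpha> * real s)) =
        exp (2 * \<i> * of_real pi * of_real \<alpha> :: complex) ^ s"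
      by (simp add: mult_ac flip: exp_of_nat_mult)
    then show "norm (exp (2 * \<i> * of_real pi * of_real (\<alpha> * real s)) - 1 :: complex) < \<delta>"
      using N[OF that] by simp
  qed
  \<comment> \<open>Level at least 1 is needed to prescribe the vertex as the end of the edge
    \<open>x n\<close>.\<close>
  have "near_int_at \<alpha> \<epsilon> n" if n: "n \<ge> max 1 N" for n
    unfolding near_int_at_def
  proof (intro conjI ballI allI impI)
    fix j assume j: "j \<in> verts B n"
    obtain x where x: "x \<in> min_upto B n" "tgt B (x n) = j" using ex_min_upto[OF j] n by auto
    have "src B (x (Suc n)) = j" using paths_step[of x B n] x n by (simp add: min_upto_def)
    then show "\<exists>z::int. \<bar>\<alpha> * real (height B n j) - of_int z\<bar> < \<epsilon>"
      using near[OF _ x(1)] return_height[OF x(1)] n by simp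
  next
    fix i es l
    assume i: "i \<in> verts B (Suc n)" and es: "distinct es" "set es = in_edges B (Suc n) i"
      "sorted_wrt (\<lambda>a b. (a, b) \<in> edge_order B) es" and l: "l < length es"
    obtain x where x: "x \<in> min_upto B (Suc n)" "tgt B (x (Suc n)) = i" using ex_min_upto[OF i] by auto
    then have "x \<in> min_upto B n" by (simp add: min_upto_def)
    then show "\<exists>z::int. \<bar>\<alpha> * real (\<Sum>k<l. height B n (src B (es ! k))) - of_int z\<bar> < \<epsilon>"
      using return_partial[OF es(1) _ es(3) x(1) l] es(2) x(2) n by (intro near) auto
  qed
  then show ?thesis by (intro exI[of _ "max 1 N"]) simp
qed

text \<open>An entry of the vector v(n); it keeps its sign because it has to satisfy a linear
  recursion.\<close>

definition dist_round :: "real \<Rightarrow> nat \<Rightarrow> nat \<Rightarrow> real" where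
  "dist_round \<alpha> n j = \<alpha> * real (height B n j) - of_int (round (\<alpha> * real (height B n j)))"

lemma dist_round_less:
  assumes "near_int_at \<alpha> \<epsilon> n" "j \<in> verts B n"
  shows "\<bar>dist_round \<alpha> n j\<bar> < \<epsilon>"
proof -
  obtain z :: int where "\<bar>\<alpha> * real (height B n j) - of_int z\<bar> < \<epsilon>"
    using assms unfolding near_int_at_def by blast
  then show ?thesis
    using round_diff_minimal[of "\<alpha> * real (height B n j)" z] by (simp add: dist_round_def)
qed

text \<open>An entry of v(n+1) = M(n+1) v(n). Both sides differ from \<alpha> times the height by
  integers, so their difference is an integer, and it vanishes because both sides are small.\<close>

lemma dist_round_Suc:
  assumes n: "near_int_at \<alpha> (1 / 8) n" "near_int_at \<alpha> (1 / 8) (Suc n)" and i: "i \<in> verts B (Suc n)"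
  shows "dist_round \<alpha> (Suc n) i = (\<Sum>e\<in>in_edges B (Suc n) i. dist_round \<alpha> n (src B e))"
proof -
  obtain es where es: "distinct es" "set es = in_edges B (Suc n) i"
    "sorted_wrt (\<lambda>a b. (a, b) \<in> edge_order B) es"
    using sorted_in_edges[of "Suc n" i] by auto
  define a where "a k = dist_round \<alpha> n (src B (es ! k))" for k
  define r where "r l = (\<Sum>k<l. round (\<alpha> * real (height B n (src B (es ! k)))))" for l
  have sum_a: "(\<Sum>k<l. a k) = \<alpha> * real (\<Sum>k<l. height B n (src B (es ! k))) - of_int (r l)" for l
    by (simp add: a_def r_def dist_round_def sum_subtractf sum_distrib_left)
  have step: "\<bar>a k\<bar> < 1 / 8" if "k < length es" for k
  proof -
    have "es ! k \<in> in_edges B (Suc n) i" using es(2) that nth_mem by blast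
    then show ?thesis unfolding a_def by (intro dist_round_less[OF n(1)] src_in_verts)
  qed
  have near: "\<exists>z::int. \<bar>(\<Sum>k<l. a k) - of_int z\<bar> < 1 / 8" if l: "l < length es" for l
  proof -
    obtain z :: int where "\<bar>\<alpha> * real (\<Sum>k<l. height B n (src B (es ! k))) - of_int z\<bar> < 1 / 8"
      using n(1) i es l unfolding near_int_at_def by blast
    then show ?thesis unfolding sum_a by (intro exI[of _ "z - r l"]) simp
  qed
  have "length es \<noteq> 0" using in_edges_nonempty[OF _ i] es(2) by auto
  then obtain L where L: "length es = Suc L" by (cases "length es") auto
  \<comment> \<open>The partial sums are controlled only up to the last edge, whose step is added
    separately to give 1/4.\<close>
  have "\<bar>\<Sum>k<L. a k\<bar> < 1 / 8"
  proof (rule partial_sums_near_zero[where L = "length es"])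
    show "L < length es" by (simp add: L)
  qed (use step near in simp_all)
  then have small: "\<bar>\<Sum>k<length es. a k\<bar> < 1 / 4"
    using step[of L] unfolding L sum.lessThan_Suc by linarith
  have height: "height B (Suc n) i = (\<Sum>k<length es. height B n (src B (es ! k)))"
    using sum_sorted_in_edges[OF es(1,2), of "\<lambda>e. height B n (src B e)"] by simp
  define z where "z = r (length es) - round (\<alpha> * real (height B (Suc n) i))"
  have "dist_round \<alpha> (Suc n) i - (\<Sum>k<length es. a k) = of_int z"
    unfolding sum_a dist_round_def height[symmetric] by (simp add: z_def del: height.simps)
  \<comment> \<open>The bound is 1/8 for the left side plus 1/4 for the sum.\<close>
  moreover from this have "\<bar>of_int z :: real\<bar> < 1" using small dist_round_less[OF n(2) i] by linarith
  then have "z = 0" by linarith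
  ultimately show ?thesis
    using sum_sorted_in_edges[OF es(1,2), of "\<lambda>e. dist_round \<alpha> n (src B e)"] by (simp add: a_def)
qed

end

section \<open>Nonvanishing of the eigenfunction, and the decomposition of \<alpha> P(m)H(1)\<close>

text \<open>An eigenfunction that vanishes at a point vanishes on its orbit, which is dense.\<close>

lemma eigenfunction_nonzero:
  fixes f :: "'a \<Rightarrow> complex"
  assumes min: "cantor_minimal_system X T"
    and f: "continuous_map X euclidean f" "\<exists>x\<in>topspace X. f x \<noteq> 0"
      "\<And>x. x \<in> topspace X \<Longrightarrow> f (T x) = lam * f x"
    and lam: "lam \<noteq> 0" and p: "p \<in> topspace X"
  shows "f p \<noteq> 0"
proof
  assume 0: "f p = 0"
  have T: "T ` topspace X = topspace X"
    using min homeomorphic_imp_surjective_map[of X X T] by (simp add: cantor_minimal_system_def)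
  let ?S = "inv_into (topspace X) T"
  let ?Z = "{x \<in> topspace X. f x \<in> {0}}"
  have "(T ^^ n) p \<in> ?Z" for n
  proof (induction n)
    case (Suc n)
    have "T ((T ^^ n) p) \<in> topspace X" using Suc T by blast
    then show ?case using Suc f(3) by simp
  qed (use 0 p in simp)
  moreover have "(?S ^^ n) p \<in> ?Z" for n
  proof (induction n)
    case (Suc n)
    define q where "q = (?S ^^ n) p"
    have q: "q \<in> T ` topspace X" "f q = 0" using Suc T by (simp_all add: q_def)
    have "?S q \<in> topspace X" "T (?S q) = q"
      using q(1) by (auto intro: inv_into_into f_inv_into_f)
    moreover from this have "f (?S q) = 0" using f(3)[of "?S q"] q(2) lam by simp
    ultimately show ?case by (simp add: q_def)
  qed (use 0 p in simp)
  ultimately have "orbit_on X T p \<subseteq> ?Z" unfolding orbit_on_def by blast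
  moreover have "closedin X ?Z" by (rule closedin_continuous_map_preimage[OF f(1)]) simp
  ultimately have "X closure_of orbit_on X T p \<subseteq> ?Z" by (rule closure_of_minimal)
  then show False using min p f(2) by (auto simp: cantor_minimal_system_def)
qed

theorem theorem5:
  fixes X :: "'a topology" and T :: "'a \<Rightarrow> 'a" and B :: "'e bratteli" and \<alpha> :: real
  assumes "cantor_minimal_system X T"
    and "given_by X T B"
    and "standing_assumptions B"
    and "continuous_eigenvalue X T (exp (2 * \<i> * of_real pi * of_real \<alpha>))"
  shows "\<exists>m\<ge>1. \<exists>v\<in>carrier_vec (nverts B m). \<exists>w\<in>carrier_vec (nverts B m).
    \<alpha> \<cdot>\<^sub>v (inc_prod B m 1 *\<^sub>v H1 B) = v + map_vec real_of_int w \<and>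
    (\<lambda>n. max_norm (inc_prod B n m *\<^sub>v v)) \<longlonglongrightarrow> 0"
proof -
  interpret proper_bratteli B
    using assms(2) by (simp add: given_by_def proper_bratteli_def)
  obtain h where h: "homeomorphic_map (path_space B) X h"
    "\<And>x. x \<in> paths B \<Longrightarrow> h (vershik B x) = T (h x)"
    using assms(2) by (auto simp: given_by_def topspace_path_space)
  define lam where "lam = exp (2 * \<i> * of_real pi * of_real \<alpha> :: complex)"
  obtain f where f: "continuous_map X euclidean f" "\<exists>x\<in>topspace X. f x \<noteq> 0"
    "\<And>x. x \<in> topspace X \<Longrightarrow> f (T x) = lam * f x"
    using assms(4) by (auto simp: continuous_eigenvalue_def lam_def)
  have hX: "h x \<in> topspace X" if "x \<in> paths B" for x
    using that homeomorphic_imp_surjective_map[OF h(1)] by (auto simp: topspace_path_space)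
  \<comment> \<open>Compactness is carried from the Cantor set through \<open>X\<close> to the path
    space by the homeomorphisms.\<close>
  have compact: "compact_space (path_space B)"
  proof -
    have "compact_space (product_topology (\<lambda>_::nat. discrete_topology (UNIV :: bool set)) UNIV)"
      by (simp add: compact_space_product_topology compact_space_discrete_topology)
    then have "compact_space X"
      using assms(1) homeomorphic_compact_space
      unfolding cantor_minimal_system_def cantor_set_def by blast
    then show ?thesis
      using homeomorphic_compact_space homeomorphic_map_imp_homeomorphic_space[OF h(1)] by blast
  qed
  obtain x0 where x0: "min_path B x0"
    using proper by (auto simp: properly_ordered_def)
  have hx0: "h x0 \<in> topspace X" using x0 hX by (simp add: min_path_def)
  have "f (h x0) \<noteq> 0"
    using eigenfunction_nonzero[OF assms(1) f _ hx0] by (simp add: lam_def)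
  moreover have "continuous_map (path_space B) euclidean (f \<circ> h)"
    using continuous_map_compose[OF homeomorphic_imp_continuous_map[OF h(1)] f(1)] .
  moreover have "(f \<circ> h) (vershik B x) = lam * (f \<circ> h) x" if "x \<in> paths B" for x
    using that h(2) f(3) hX by simp
  ultimately have near: "\<exists>N\<ge>1. \<forall>n\<ge>N. near_int_at \<alpha> \<epsilon> n" if "\<epsilon> > 0" for \<epsilon>
    using eigenvalue_near_int[OF compact _ _ x0 _ that, of "f \<circ> h" \<alpha>] by (simp add: lam_def)
  \<comment> \<open>1/8 is the threshold of \<open>dist_round_Suc\<close>, so the recursion holds
    from level \<open>m\<close> on; \<open>m\<close> is fixed before any \<epsilon>.\<close>
  obtain m where m: "m \<ge> 1" "\<And>n. n \<ge> m \<Longrightarrow> near_int_at \<alpha> (1 / 8) n"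
    using near[of "1 / 8"] by auto
  define v where "v n = Matrix.vec (nverts B n) (\<lambda>j. dist_round \<alpha> n (Suc j))" for n
  define w where "w = Matrix.vec (nverts B m) (\<lambda>j. round (\<alpha> * real (height B m (Suc j))))"
  have height_1: "height B (Suc 0) i = 1" if i: "i \<in> verts B (Suc 0)" for i
  proof -
    have "\<exists>!e. e \<in> edges B 1 \<and> tgt B e = i"
      using assms(3) i by (simp add: standing_assumptions_def)
    then obtain e where "in_edges B (Suc 0) i = {e}" by (auto simp: in_edges_def)
    then show ?thesis by simp
  qed
  have "H1 B = Matrix.vec (nverts B 1) (\<lambda>j. real (height B 1 (Suc j)))"
    unfolding H1_def using height_1 by (intro eq_vecI) (simp_all add: verts_def)
  \<comment> \<open>Heights satisfy the recursion by definition, so P(m)H(1) is the vector of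
    heights of level \<open>m\<close>.\<close>
  then have "inc_prod B m 1 *\<^sub>v H1 B = Matrix.vec (nverts B m) (\<lambda>j. real (height B m (Suc j)))"
    using inc_prod_mult_vec[of 1 m "\<lambda>n i. real (height B n i)"] m(1) by simp
  then have "\<alpha> \<cdot>\<^sub>v (inc_prod B m 1 *\<^sub>v H1 B) = v m + map_vec real_of_int w"
    by (intro eq_vecI) (simp_all add: v_def w_def dist_round_def)
  moreover have "(\<lambda>n. max_norm (inc_prod B n m *\<^sub>v v m)) \<longlonglongrightarrow> 0"
  proof (rule LIMSEQ_I)
    fix \<epsilon> :: real
    assume "\<epsilon> > 0"
    then obtain N where N: "N \<ge> 1" "\<And>n. n \<ge> N \<Longrightarrow> near_int_at \<alpha> \<epsilon> n" using near by blast
    have "norm (max_norm (inc_prod B n m *\<^sub>v v m) - 0) < \<epsilon>" if n: "n \<ge> max m N" for n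
    proof -
      \<comment> \<open>The product carries the rounding errors of level \<open>m\<close> to those
        of level \<open>n\<close>, which are below \<epsilon> once \<open>n \<ge> N\<close>.\<close>
      have "inc_prod B n m *\<^sub>v v m = v n"
        unfolding v_def using n m by (intro inc_prod_mult_vec dist_round_Suc) auto
      moreover have "0 < dim_vec (v n)"
        using verts_nonempty[of n] n N(1) by (simp add: v_def verts_def)
      moreover have "\<bar>v n $ i\<bar> < \<epsilon>" if "i < dim_vec (v n)" for i
        using that dist_round_less[OF N(2), of n "Suc i"] n N(1) by (simp add: v_def verts_def)
      ultimately show ?thesis using max_norm_less by simp
    qed
    then show "\<exists>N. \<forall>n\<ge>N. norm (max_norm (inc_prod B n m *\<^sub>v v m) - 0) < \<epsilon>" by blast
  qed
  moreover have "v m \<in> carrier_vec (nverts B m)" "w \<in> carrier_vec (nverts B m)"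
    by (simp_all add: v_def w_def)
  ultimately show ?thesis using m(1) by blast
qed

end
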